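(* Let $M^2: z=z(u,v)$ be a surface in $\mathbb R^4$ without flat points, and let $g$ be a tangent at a point $p\in M^2$. Then $g$ is asymptotic if and only if its normal curvature vanishes, $\nu_g=0$.
   Context: $M^2: z=z(u,v)$, $(u,v)\in\mathcal D\subset\mathbb R^2$, is a smooth regular 2-dimensional surface in Euclidean $\mathbb R^4$, with tangent space $T_pM^2=\mathrm{span}\{z_u,z_v\}$. $E,F,G$ are the coefficients of the first fundamental form $I(\lambda,\mu)=E\lambda^2+2F\lambda\mu+G\mu^2$, and $W=\sqrt{EG-F^2}$. $\{e_1,e_2\}$ is an orthonormal normal frame field chosen so that $\{z_u,z_v,e_1,e_2\}$ is positively oriented in $\mathbb R^4$. $\sigma$ is the vector-valued second fundamental tensor (normal part of the second derivative). The oriented area of the parallelogram of an ordered pair of normal vectors is $S(a^1e_1+a^2e_2,\;b^1e_1+b^2e_2)=a^1b^2-a^2b^1$. Put $L=\frac{2}{W}S(\sigma(z_u,z_u),\sigma(z_u,z_v))$, $M=\frac{1}{W}S(\sigma(z_u,z_u),\sigma(z_v,z_v))$, $N=\frac{2}{W}S(\sigma(z_u,z_v),\sigma(z_v,z_v))$. A point is flat if $L=M=N=0$ there. A tangent $g$ at $p$ is a line through the origin of $T_pM^2$, determined by a nonzero vector $X=\lambda z_u+\mu z_v$. For such $g$ define the linear map $\sigma_g:T_pM^2\to(T_pM^2)^\perp$, $\sigma_g(Y)=\sigma\left(\frac{\lambda z_u+\mu z_v}{\sqrt{I(\lambda,\mu)}},Y\right)$. For two tangents $g_1,g_2$ at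 $p$ define $$\zeta_{g_1,g_2}=\frac{S(\sigma_{g_1}(z_u),\sigma_{g_2}(z_v))}{W}+\frac{S(\sigma_{g_2}(z_u),\sigma_{g_1}(z_v))}{W}.$$ Two tangents $g_1,g_2$ are conjugate if $\zeta_{g_1,g_2}=0$. A tangent is asymptotic if it is self-conjugate (conjugate to itself). The normal curvature of $g$ is $\nu_g=\zeta_{g,g}$ (the same vector $X$ being used for both entries). *)

theory Defs
  imports "HOL-Analysis.Analysis"
begin

text \<open>
  A surface is given by a map \<open>z\<close> of the parameters \<open>(u, v)\<close>; a point of the surface is
  addressed by its parameter pair, since \<open>z\<close> is only an immersion and need not be injective.
\<close>

type_synonym surface_map = "real \<times> real \<Rightarrow> real ^ 4"

definition pd_u :: "(real \<times> real \<Rightarrow> 'a::real_normed_vector) \<Rightarrow> real \<times> real \<Rightarrow> 'a" where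
  "pd_u f p = vector_derivative (\<lambda>t. f (t, snd p)) (at (fst p))"

definition pd_v :: "(real \<times> real \<Rightarrow> 'a::real_normed_vector) \<Rightarrow> real \<times> real \<Rightarrow> 'a" where
  "pd_v f p = vector_derivative (\<lambda>t. f (fst p, t)) (at (snd p))"

primrec Ck_on :: "nat \<Rightarrow> (real \<times> real) set \<Rightarrow> (real \<times> real \<Rightarrow> 'a::real_normed_vector) \<Rightarrow> bool" where
  "Ck_on 0 D f \<longleftrightarrow> continuous_on D f"
| "Ck_on (Suc k) D f \<longleftrightarrow>
     (\<forall>p\<in>D. f differentiable (at p)) \<and> Ck_on k D (pd_u f) \<and> Ck_on k D (pd_v f)"

definition regular_surface :: "surface_map \<Rightarrow> (real \<times> real) set \<Rightarrow> bool" where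
  "regular_surface z D \<longleftrightarrow>
     open D \<and> (\<forall>k. Ck_on k D z) \<and>
     (\<forall>p\<in>D. pd_u z p \<noteq> pd_v z p \<and> independent {pd_u z p, pd_v z p})"

definition tangent_space :: "surface_map \<Rightarrow> real \<times> real \<Rightarrow> (real ^ 4) set" where
  "tangent_space z p = span {pd_u z p, pd_v z p}"

definition E_coeff :: "surface_map \<Rightarrow> real \<times> real \<Rightarrow> real" where
  "E_coeff z p = pd_u z p \<bullet> pd_u z p"

definition F_coeff :: "surface_map \<Rightarrow> real \<times> real \<Rightarrow> real" where
  "F_coeff z p = pd_u z p \<bullet> pd_v z p"

definition G_coeff :: "surface_map \<Rightarrow> real \<times> real \<Rightarrow> real" where
  "G_coeff z p = pd_v z p \<bullet> pd_v z p"

definition first_form :: "surface_map \<Rightarrow> real \<times> real \<Rightarrow> real \<Rightarrow> real \<Rightarrow> real" where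
  "first_form z p a b = E_coeff z p * a\<^sup>2 + 2 * F_coeff z p * a * b + G_coeff z p * b\<^sup>2"

definition W_coeff :: "surface_map \<Rightarrow> real \<times> real \<Rightarrow> real" where
  "W_coeff z p = sqrt (E_coeff z p * G_coeff z p - (F_coeff z p)\<^sup>2)"

text \<open>
  No continuity of the frame is required, so a frame in this sense always exists. The oriented
  area below does not depend on which positively oriented frame is used.
\<close>

definition normal_frame ::
    "surface_map \<Rightarrow> (real \<times> real) set \<Rightarrow> surface_map \<Rightarrow> surface_map \<Rightarrow> bool" where
  "normal_frame z D e1 e2 \<longleftrightarrow>
     (\<forall>p\<in>D. e1 p \<in> (tangent_space z p)\<^sup>\<bottom> \<and> e2 p \<in> (tangent_space z p)\<^sup>\<bottom> \<and>
        norm (e1 p) = 1 \<and> norm (e2 p) = 1 \<and> e1 p \<bullet> e2 p = 0 \<and>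
        det (vector [pd_u z p, pd_v z p, e1 p, e2 p] :: real ^ 4 ^ 4) > 0)"

definition normal_part :: "surface_map \<Rightarrow> real \<times> real \<Rightarrow> real ^ 4 \<Rightarrow> real ^ 4" where
  "normal_part z p x =
     (THE n. n \<in> (tangent_space z p)\<^sup>\<bottom> \<and> x - n \<in> tangent_space z p)"

text \<open>
  The second derivative of \<open>z\<close> at \<open>p\<close>, a symmetric bilinear map on the parameter plane, is
  transported to the tangent space by writing its arguments in the basis of coordinate tangent
  vectors; the coefficients are unique where \<open>z\<close> is regular.
\<close>

definition second_form :: "surface_map \<Rightarrow> real \<times> real \<Rightarrow> real ^ 4 \<Rightarrow> real ^ 4 \<Rightarrow> real ^ 4" where
  "second_form z p X Y =
     (THE n. \<exists>a b c d. X = a *\<^sub>R pd_u z p + b *\<^sub>R pd_v z p \<and> Y = c *\<^sub>R pd_u z p + d *\<^sub>R pd_v z p \<and>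
        n = normal_part z p
              ((a * c) *\<^sub>R pd_u (pd_u z) p + (a * d + b * c) *\<^sub>R pd_v (pd_u z) p
                + (b * d) *\<^sub>R pd_v (pd_v z) p))"

text \<open>For an orthonormal frame, the coordinates of a normal vector are its inner products with
  the frame vectors.\<close>

definition oriented_area ::
    "surface_map \<Rightarrow> surface_map \<Rightarrow> real \<times> real \<Rightarrow> real ^ 4 \<Rightarrow> real ^ 4 \<Rightarrow> real" where
  "oriented_area e1 e2 p x y = (x \<bullet> e1 p) * (y \<bullet> e2 p) - (x \<bullet> e2 p) * (y \<bullet> e1 p)"

definition L_coeff :: "surface_map \<Rightarrow> surface_map \<Rightarrow> surface_map \<Rightarrow> real \<times> real \<Rightarrow> real" where
  "L_coeff z e1 e2 p = 2 / W_coeff z p *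
     oriented_area e1 e2 p (second_form z p (pd_u z p) (pd_u z p))
                           (second_form z p (pd_u z p) (pd_v z p))"

definition M_coeff :: "surface_map \<Rightarrow> surface_map \<Rightarrow> surface_map \<Rightarrow> real \<times> real \<Rightarrow> real" where
  "M_coeff z e1 e2 p = 1 / W_coeff z p *
     oriented_area e1 e2 p (second_form z p (pd_u z p) (pd_u z p))
                           (second_form z p (pd_v z p) (pd_v z p))"

definition N_coeff :: "surface_map \<Rightarrow> surface_map \<Rightarrow> surface_map \<Rightarrow> real \<times> real \<Rightarrow> real" where
  "N_coeff z e1 e2 p = 2 / W_coeff z p *
     oriented_area e1 e2 p (second_form z p (pd_u z p) (pd_v z p))
                           (second_form z p (pd_v z p) (pd_v z p))"

definition flat_point :: "surface_map \<Rightarrow> surface_map \<Rightarrow> surface_map \<Rightarrow> real \<times> real \<Rightarrow> bool" where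
  "flat_point z e1 e2 p \<longleftrightarrow>
     L_coeff z e1 e2 p = 0 \<and> M_coeff z e1 e2 p = 0 \<and> N_coeff z e1 e2 p = 0"

text \<open>The pair \<open>(a, b)\<close> plays the role of the coordinates of a vector determining the line \<open>g\<close>.\<close>

definition determines :: "surface_map \<Rightarrow> real \<times> real \<Rightarrow> real \<times> real \<Rightarrow> (real ^ 4) set \<Rightarrow> bool" where
  "determines z p = (\<lambda>(a, b) g.
     a *\<^sub>R pd_u z p + b *\<^sub>R pd_v z p \<noteq> 0 \<and> g = span {a *\<^sub>R pd_u z p + b *\<^sub>R pd_v z p})"

definition is_tangent :: "surface_map \<Rightarrow> real \<times> real \<Rightarrow> (real ^ 4) set \<Rightarrow> bool" where
  "is_tangent z p g \<longleftrightarrow> (\<exists>x. determines z p x g)"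

definition sigma_dir :: "surface_map \<Rightarrow> real \<times> real \<Rightarrow> real \<times> real \<Rightarrow> real ^ 4 \<Rightarrow> real ^ 4" where
  "sigma_dir z p = (\<lambda>(a, b) Y.
     second_form z p ((1 / sqrt (first_form z p a b)) *\<^sub>R (a *\<^sub>R pd_u z p + b *\<^sub>R pd_v z p)) Y)"

definition zeta ::
    "surface_map \<Rightarrow> surface_map \<Rightarrow> surface_map \<Rightarrow> real \<times> real \<Rightarrow>
     real \<times> real \<Rightarrow> real \<times> real \<Rightarrow> real" where
  "zeta z e1 e2 p x1 x2 =
     oriented_area e1 e2 p (sigma_dir z p x1 (pd_u z p)) (sigma_dir z p x2 (pd_v z p)) / W_coeff z p
   + oriented_area e1 e2 p (sigma_dir z p x2 (pd_u z p)) (sigma_dir z p x1 (pd_v z p)) / W_coeff z p"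

text \<open>
  The value of \<open>zeta\<close> changes sign when one determining vector is replaced by its opposite, so
  for two lines only its vanishing is meaningful. In particular, the two vectors chosen to test
  self-conjugacy of a line are independent of each other. For the normal curvature the same vector
  is used in both entries, and the value is then determined by the line.
\<close>

definition conjugate_tangents ::
    "surface_map \<Rightarrow> surface_map \<Rightarrow> surface_map \<Rightarrow> real \<times> real \<Rightarrow>
     (real ^ 4) set \<Rightarrow> (real ^ 4) set \<Rightarrow> bool" where
  "conjugate_tangents z e1 e2 p g1 g2 \<longleftrightarrow>
     (\<exists>x1 x2. determines z p x1 g1 \<and> determines z p x2 g2 \<and> zeta z e1 e2 p x1 x2 = 0)"

definition asymptotic_tangent ::
    "surface_map \<Rightarrow> surface_map \<Rightarrow> surface_map \<Rightarrow> real \<times> real \<Rightarrow> (real ^ 4) set \<Rightarrow> bool" where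
  "asymptotic_tangent z e1 e2 p g \<longleftrightarrow> conjugate_tangents z e1 e2 p g g"

definition normal_curvature ::
    "surface_map \<Rightarrow> surface_map \<Rightarrow> surface_map \<Rightarrow> real \<times> real \<Rightarrow> (real ^ 4) set \<Rightarrow> real" where
  "normal_curvature z e1 e2 p g =
     (THE r. \<exists>x. determines z p x g \<and> r = zeta z e1 e2 p x x)"

end

theory Submission
  imports Defs
begin

text \<open>
  A line has many determining vectors, any two of them proportional with a nonzero factor \<open>c\<close>.
  The map \<open>\<sigma>\<^sub>g\<close> is built from the unit vector along the determining vector, so replacing \<open>x\<close> by
  \<open>c x\<close> multiplies \<open>\<sigma>\<^sub>g\<close> by the sign of \<open>c\<close> only (lemma \<open>sigma_dir_scale\<close>).  Since \<open>\<zeta>\<close> is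
  bilinear in the two maps \<open>\<sigma>\<^sub>g\<close>, it is multiplied by the product of the two signs
  (lemma \<open>zeta_scale\<close>).

  Taking the same vector in both entries gives the factor \<open>1\<close>, so the value defining \<open>\<nu>\<^sub>g\<close> depends
  on the line alone.  Taking two different determining vectors of \<open>g\<close>, as self-conjugacy permits,
  gives \<open>\<nu>\<^sub>g\<close> or \<open>- \<nu>\<^sub>g\<close>, and one of these vanishes exactly when the other does.

  What remains is that the descriptions behind \<open>\<sigma>\<close> have a unique solution: the normal
  component of a vector comes from the orthogonal decomposition with respect to the tangent plane,
  and coordinates in the basis \<open>z\<^sub>u, z\<^sub>v\<close> are unique because the surface is regular.
\<close>

section \<open>The normal component\<close>

lemma normal_part_eqI:
  assumes "n \<in> (tangent_space z p)\<^sup>\<bottom>" and "x - n \<in> tangent_space z p"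
  shows "normal_part z p x = n"
  unfolding normal_part_def
proof (rule the_equality)
  fix m
  assume m: "m \<in> (tangent_space z p)\<^sup>\<bottom> \<and> x - m \<in> tangent_space z p"
  \<comment> \<open>The difference of two candidates is tangent and normal, hence orthogonal to itself.\<close>
  have "(x - n) - (x - m) \<in> tangent_space z p"
    using assms m unfolding tangent_space_def by (blast intro: span_diff)
  then have tangent: "m - n \<in> tangent_space z p"
    by simp
  have "m - n \<in> (tangent_space z p)\<^sup>\<bottom>"
    using assms m by (simp add: subspace_diff subspace_orthogonal_comp)
  with tangent have "(m - n) \<bullet> (m - n) = 0"
    unfolding orthogonal_comp_def orthogonal_def by blast
  then show "m = n"
    by simp
qed (use assms in blast)

lemma normal_part_decomp:
  shows "normal_part z p x \<in> (tangent_space z p)\<^sup>\<bottom>"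
    and "x - normal_part z p x \<in> tangent_space z p"
proof -
  obtain y n where "y \<in> tangent_space z p"
    and n: "\<And>w. w \<in> tangent_space z p \<Longrightarrow> orthogonal n w" and "x = y + n"
    using orthogonal_subspace_decomp_exists[of "{pd_u z p, pd_v z p}" x]
    unfolding tangent_space_def by blast
  moreover have "n \<in> (tangent_space z p)\<^sup>\<bottom>"
    using n by (auto simp: orthogonal_comp_def orthogonal_commute)
  ultimately have dec: "n \<in> (tangent_space z p)\<^sup>\<bottom>" "x - n \<in> tangent_space z p"
    by simp_all
  then show "normal_part z p x \<in> (tangent_space z p)\<^sup>\<bottom>"
    and "x - normal_part z p x \<in> tangent_space z p"
    using normal_part_eqI by metis+
qed

lemma normal_part_scale: "normal_part z p (c *\<^sub>R x) = c *\<^sub>R normal_part z p x"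
proof (rule normal_part_eqI)
  show "c *\<^sub>R normal_part z p x \<in> (tangent_space z p)\<^sup>\<bottom>"
    by (simp add: normal_part_decomp(1) subspace_scale subspace_orthogonal_comp)
  have "c *\<^sub>R (x - normal_part z p x) \<in> tangent_space z p"
    using normal_part_decomp(2)[of x z p] unfolding tangent_space_def by (rule span_scale)
  then show "c *\<^sub>R x - c *\<^sub>R normal_part z p x \<in> tangent_space z p"
    by (simp only: scaleR_diff_right)
qed

section \<open>The second fundamental tensor\<close>

lemma in_span_pair:
  fixes w x y :: "'a::real_vector"
  assumes "w \<in> span {x, y}"
  obtains a b where "w = a *\<^sub>R x + b *\<^sub>R y"
proof -
  obtain a where "w - a *\<^sub>R x \<in> span {y}"
    using assms span_breakdown_eq[of w x "{y}"] by blast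
  then obtain b where "w - a *\<^sub>R x = b *\<^sub>R y"
    by (auto simp: span_singleton)
  then show thesis
    using that by (metis add.commute diff_add_cancel)
qed

lemma independent_pair_coords_unique:
  fixes x y :: "'a::real_vector"
  assumes ind: "independent {x, y}" and "x \<noteq> y"
    and eq: "a *\<^sub>R x + b *\<^sub>R y = c *\<^sub>R x + d *\<^sub>R y"
  shows "a = c \<and> b = d"
proof -
  define k where "k w = (if w = x then a - c else b - d)" for w
  have "(\<Sum>w\<in>{x, y}. k w *\<^sub>R w) = 0"
    using \<open>x \<noteq> y\<close> eq by (simp add: k_def algebra_simps)
  then have "\<forall>w\<in>{x, y}. k w = 0"
    using ind dependent_finite[of "{x, y}"] by auto
  then show ?thesis
    using \<open>x \<noteq> y\<close> by (simp add: k_def)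
qed

text \<open>
  Uniqueness of coordinates makes the description that defines \<open>\<sigma>\<close> proper, so it can be replaced by
  the bilinear expression in the second derivatives of \<open>z\<close>.
\<close>

lemma second_form_coords:
  assumes ind: "independent {pd_u z p, pd_v z p}" and ne: "pd_u z p \<noteq> pd_v z p"
  shows "second_form z p (a *\<^sub>R pd_u z p + b *\<^sub>R pd_v z p) (c *\<^sub>R pd_u z p + d *\<^sub>R pd_v z p) =
    normal_part z p ((a * c) *\<^sub>R pd_u (pd_u z) p + (a * d + b * c) *\<^sub>R pd_v (pd_u z) p
                      + (b * d) *\<^sub>R pd_v (pd_v z) p)"
  unfolding second_form_def
  using independent_pair_coords_unique[OF ind ne]
  by (intro the_equality; (elim exE conjE)?) (metis, metis)

lemma second_form_scale_left:
  assumes ind: "independent {pd_u z p, pd_v z p}" and ne: "pd_u z p \<noteq> pd_v z p"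
    and "X \<in> tangent_space z p" and "Y \<in> tangent_space z p"
  shows "second_form z p (r *\<^sub>R X) Y = r *\<^sub>R second_form z p X Y"
proof -
  obtain a b c d where
    X: "X = a *\<^sub>R pd_u z p + b *\<^sub>R pd_v z p" and Y: "Y = c *\<^sub>R pd_u z p + d *\<^sub>R pd_v z p"
    using assms(3,4) unfolding tangent_space_def by (metis in_span_pair)
  have rX: "r *\<^sub>R X = (r * a) *\<^sub>R pd_u z p + (r * b) *\<^sub>R pd_v z p"
    unfolding X by (simp add: algebra_simps)
  show ?thesis
    unfolding rX unfolding X Y second_form_coords[OF ind ne] normal_part_scale[symmetric]
    by (simp add: scaleR_add_right distrib_left mult.assoc)
qed

section \<open>Dependence on the determining vector\<close>

text \<open>
  The factor \<open>c\<close> of the vector is divided by the factor \<open>\<bar>c\<bar>\<close> of its length, which leaves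
  the sign of \<open>c\<close>.  For \<open>c = 0\<close> both sides are \<open>0\<close>, because \<open>sgn 0 = 0\<close> and \<open>\<sigma>\<close> vanishes at the
  zero vector.
\<close>

lemma sigma_dir_scale:
  assumes ind: "independent {pd_u z p, pd_v z p}" and ne: "pd_u z p \<noteq> pd_v z p"
    and Y: "Y \<in> tangent_space z p"
  shows "sigma_dir z p (c *\<^sub>R x) Y = sgn c *\<^sub>R sigma_dir z p x Y"
proof -
  obtain a b where x: "x = (a, b)"
    by fastforce
  define X where
    "X = (1 / sqrt (first_form z p a b)) *\<^sub>R (a *\<^sub>R pd_u z p + b *\<^sub>R pd_v z p)"
  have X: "X \<in> tangent_space z p"
    unfolding X_def tangent_space_def by (intro span_scale span_add) (simp_all add: span_base)
  have "first_form z p (c * a) (c * b) = c\<^sup>2 * first_form z p a b"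
    by (simp add: first_form_def power2_eq_square algebra_simps)
  then have sqrt_scale: "sqrt (first_form z p (c * a) (c * b)) = \<bar>c\<bar> * sqrt (first_form z p a b)"
    by (simp add: real_sqrt_mult)
  have "(c * a) *\<^sub>R pd_u z p + (c * b) *\<^sub>R pd_v z p = c *\<^sub>R (a *\<^sub>R pd_u z p + b *\<^sub>R pd_v z p)"
    by (simp add: algebra_simps)
  then have "(1 / sqrt (first_form z p (c * a) (c * b))) *\<^sub>R
      ((c * a) *\<^sub>R pd_u z p + (c * b) *\<^sub>R pd_v z p) = sgn c *\<^sub>R X"
    unfolding sqrt_scale X_def by (cases "c = 0") (simp_all add: sgn_if)
  then have "sigma_dir z p (c *\<^sub>R x) Y = second_form z p (sgn c *\<^sub>R X) Y"
    unfolding sigma_dir_def x scaleR_Pair prod.case real_scaleR_def by (rule arg_cong)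
  also have "\<dots> = sgn c *\<^sub>R sigma_dir z p x Y"
    unfolding second_form_scale_left[OF ind ne X Y] by (simp only: sigma_dir_def x X_def prod.case)
  finally show ?thesis .
qed

lemma oriented_area_scale:
  "oriented_area e1 e2 p (r *\<^sub>R x) (s *\<^sub>R y) = r * s * oriented_area e1 e2 p x y"
  by (simp add: oriented_area_def algebra_simps)

lemma zeta_scale:
  assumes "independent {pd_u z p, pd_v z p}" and "pd_u z p \<noteq> pd_v z p"
  shows "zeta z e1 e2 p (c *\<^sub>R x) (d *\<^sub>R y) = sgn c * sgn d * zeta z e1 e2 p x y"
proof -
  have "pd_u z p \<in> tangent_space z p" "pd_v z p \<in> tangent_space z p"
    by (simp_all add: tangent_space_def span_base)
  then show ?thesis
    by (simp add: zeta_def sigma_dir_scale[OF assms] oriented_area_scale distrib_left mult_ac)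
qed

lemma determines_proportional:
  assumes ind: "independent {pd_u z p, pd_v z p}" and ne: "pd_u z p \<noteq> pd_v z p"
    and "determines z p x g" and "determines z p y g"
  obtains c where "c \<noteq> 0" and "y = c *\<^sub>R x"
proof -
  obtain a b a' b' where x: "x = (a, b)" and y: "y = (a', b')"
    by fastforce
  let ?X = "a *\<^sub>R pd_u z p + b *\<^sub>R pd_v z p" and ?Y = "a' *\<^sub>R pd_u z p + b' *\<^sub>R pd_v z p"
  have "?Y \<noteq> 0" and "span {?X} = span {?Y}"
    using assms(3,4) by (auto simp: determines_def x y)
  then have "?Y \<in> span {?X}"
    by (simp add: span_base)
  then obtain c where c: "?Y = c *\<^sub>R ?X"
    by (auto simp: span_singleton)
  then have "a' *\<^sub>R pd_u z p + b' *\<^sub>R pd_v z p = (c * a) *\<^sub>R pd_u z p + (c * b) *\<^sub>R pd_v z p"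
    by (simp add: algebra_simps)
  then have "y = c *\<^sub>R x"
    using independent_pair_coords_unique[OF ind ne] by (simp add: x y)
  moreover have "c \<noteq> 0"
    using c \<open>?Y \<noteq> 0\<close> by auto
  ultimately show thesis
    using that by blast
qed

lemma normal_curvature_eq_zeta:
  assumes ind: "independent {pd_u z p, pd_v z p}" and ne: "pd_u z p \<noteq> pd_v z p"
    and x: "determines z p x g"
  shows "normal_curvature z e1 e2 p g = zeta z e1 e2 p x x"
  unfolding normal_curvature_def
proof (rule the_equality)
  fix r
  assume "\<exists>y. determines z p y g \<and> r = zeta z e1 e2 p y y"
  then obtain y where y: "determines z p y g" and r: "r = zeta z e1 e2 p y y"
    by blast
  obtain c where "c \<noteq> 0" "y = c *\<^sub>R x"
    using determines_proportional[OF ind ne x y] .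
  then show "r = zeta z e1 e2 p x x"
    by (simp add: r zeta_scale[OF ind ne] sgn_mult_self_eq)
qed (use x in blast)

section \<open>Asymptotic tangents\<close>

theorem proposition2p4:
  fixes z e1 e2 :: "real \<times> real \<Rightarrow> real ^ 4"
    and D :: "(real \<times> real) set" and p :: "real \<times> real" and g :: "(real ^ 4) set"
  assumes "regular_surface z D"
    and "normal_frame z D e1 e2"
    and "\<forall>q\<in>D. \<not> flat_point z e1 e2 q"
    and "p \<in> D"
    and "is_tangent z p g"
  shows "asymptotic_tangent z e1 e2 p g \<longleftrightarrow> normal_curvature z e1 e2 p g = 0"
proof -
  have ind: "independent {pd_u z p, pd_v z p}" and ne: "pd_u z p \<noteq> pd_v z p"
    using assms(1,4) by (auto simp: regular_surface_def)
  note curvature = normal_curvature_eq_zeta[OF ind ne]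
  show ?thesis
  proof
    assume "asymptotic_tangent z e1 e2 p g"
    then obtain x y where x: "determines z p x g" and y: "determines z p y g"
      and zero: "zeta z e1 e2 p x y = 0"
      unfolding asymptotic_tangent_def conjugate_tangents_def by blast
    obtain c where "c \<noteq> 0" "y = c *\<^sub>R x"
      using determines_proportional[OF ind ne x y] .
    then have "zeta z e1 e2 p x y = sgn c * zeta z e1 e2 p x x"
      using zeta_scale[OF ind ne, of e1 e2 1 x c x] by simp
    then show "normal_curvature z e1 e2 p g = 0"
      using zero \<open>c \<noteq> 0\<close> by (simp add: curvature[OF x] sgn_zero_iff)
  next
    assume "normal_curvature z e1 e2 p g = 0"
    moreover obtain x where "determines z p x g"
      using assms(5) unfolding is_tangent_def by blast
    ultimately show "asymptotic_tangent z e1 e2 p g"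
      unfolding asymptotic_tangent_def conjugate_tangents_def using curvature by metis
  qed
qed

end
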